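(* (Approximation Lemma.) Let $n\in\mathbb N$, let $\alpha$ and $\beta$ be s-tensor norms of order $n$, let $E$ be a normed space with the $\lambda$-bounded approximation property, and let $c\ge 0$ be such that $$\alpha(\,\cdot\,;\otimes^{n,s}M)\le c\,\beta(\,\cdot\,;\otimes^{n,s}M)\quad\text{on } \otimes^{n,s}M$$ for cofinally many $M\in FIN(E)$. Then $$\alpha(\,\cdot\,;\otimes^{n,s}E)\le \lambda^n c\,\beta(\,\cdot\,;\otimes^{n,s}E)\quad\text{on }\otimes^{n,s}E .$$
   Context: Normed spaces are over $\mathbb K=\mathbb R$ or $\mathbb C$. $FIN(E)$ is the set of finite dimensional subspaces of $E$; "for cofinally many $M\in FIN(E)$" means for all $M$ in some subset of $FIN(E)$ such that every $N\in FIN(E)$ is contained in a member of that subset. $\mathcal L(E,F)$ is the space of continuous linear operators. $E$ has the $\lambda$-bounded approximation property if there is a net $(T_\eta)$ of finite rank operators in $\mathcal L(E,E)$ with $\|T_\eta\|\le\lambda$ converging to $\mathrm{Id}_E$ uniformly on compact subsets of $E$. $\otimes^{n,s}E$ (the $n$-fold symmetric tensor product) is the linear span in $\otimes^nE$ of the elements $\otimes^n x=x\otimes\cdots\otimes x$, $x\in E$. For $T\in\mathcal L(E,F)$, $\otimes^{n,s}T:\otimes^{n,s}E\to\otimes^{n,s}F$ is the linear map with $\otimes^n x\mapsto\otimes^n(Tx)$. For $z\in\otimes^{n,s}E$: $\pi_s(z)=\inf\{\sum_j|\lambda_j|\|x_j\|^n\}$ over all representations $z=\sum_{j=1}^r\lambda_j\otimes^n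 x_j$, and $\varepsilon_s(z)=\sup_{x'\in B_{E'}}|\sum_j\lambda_j x'(x_j)^n|$ for any such representation. An s-tensor norm $\alpha$ of order $n$ assigns to each normed space $E$ a norm $\alpha(\,\cdot\,;\otimes^{n,s}E)$ on $\otimes^{n,s}E$ such that (1) $\varepsilon_s\le\alpha\le\pi_s$ and (2) $\alpha((\otimes^{n,s}T)z;\otimes^{n,s}F)\le\|T\|^n\alpha(z;\otimes^{n,s}E)$ for all $T\in\mathcal L(E,F)$ and $z\in\otimes^{n,s}E$. *)

theory Defs
  imports "HOL-Analysis.Analysis" "HOL-Algebra.Module" "HOL-Library.Function_Algebras"
begin

text \<open>
  Scalars are taken from a type of class \<open>real_normed_field\<close>; by the Gelfand-Mazur theorem the
  only such fields are, up to isometric isomorphism, the reals and the complex numbers.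

  A normed space is a \<^const>\<open>Module.module\<close> over the scalars, on an arbitrary carrier set inside
  a type, together with a norm. The record fields \<open>mult\<close> and \<open>one\<close> that HOL-Algebra modules
  inherit from rings, and all values outside the carrier, are irrelevant.
\<close>

record ('k, 'a) normed = "('k, 'a) module" +
  nrm :: "'a \<Rightarrow> real"

definition scalars :: "('k::real_normed_field, 'k) normed" where
  "scalars = \<lparr>carrier = UNIV, mult = (*), one = 1, zero = 0, add = (+), smult = (*), nrm = norm\<rparr>"

locale normed_space = Module.module scalars E
  for E :: "('k::real_normed_field, 'a) normed" (structure) +
  assumes nrm_eq_0: "x \<in> carrier E \<Longrightarrow> nrm E x = 0 \<longleftrightarrow> x = \<zero>\<^bsub>E\<^esub>"
    and nrm_add: "x \<in> carrier E \<Longrightarrow> y \<in> carrier E \<Longrightarrow> nrm E (x \<oplus>\<^bsub>E\<^esub> y) \<le> nrm E x + nrm E y"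
    and nrm_smult: "x \<in> carrier E \<Longrightarrow> nrm E (a \<odot>\<^bsub>E\<^esub> x) = norm a * nrm E x"

text \<open>
  \<^const>\<open>Metric_space\<close> wants nonnegativity and symmetry on the whole type, hence the case
  distinction.
\<close>

definition ndist :: "('k, 'a) normed \<Rightarrow> 'a \<Rightarrow> 'a \<Rightarrow> real" where
  "ndist E x y = (if x \<in> carrier E \<and> y \<in> carrier E then nrm E (x \<ominus>\<^bsub>E\<^esub> y) else 0)"

definition ntop :: "('k, 'a) normed \<Rightarrow> 'a topology" where
  "ntop E = Metric_space.mtopology (carrier E) (ndist E)"

text \<open>The normed space carried by a linear subspace \<open>M\<close> of \<open>E\<close> is \<open>E\<lparr>carrier := M\<rparr>\<close>.\<close>

definition FIN :: "('k::real_normed_field, 'a) normed \<Rightarrow> 'a set set" where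
  "FIN E = {M. submodule M scalars E \<and>
     (\<exists>B. finite B \<and> B \<subseteq> M \<and> (\<forall>N. submodule N scalars E \<and> B \<subseteq> N \<longrightarrow> M \<subseteq> N))}"

definition lin_map :: "('k, 'a) normed \<Rightarrow> ('k, 'b) normed \<Rightarrow> ('a \<Rightarrow> 'b) \<Rightarrow> bool" where
  "lin_map E F T \<longleftrightarrow> T \<in> carrier E \<rightarrow> carrier F \<and>
     (\<forall>x\<in>carrier E. \<forall>y\<in>carrier E. T (x \<oplus>\<^bsub>E\<^esub> y) = T x \<oplus>\<^bsub>F\<^esub> T y) \<and>
     (\<forall>a. \<forall>x\<in>carrier E. T (a \<odot>\<^bsub>E\<^esub> x) = a \<odot>\<^bsub>F\<^esub> T x)"

definition operators :: "('k, 'a) normed \<Rightarrow> ('k, 'b) normed \<Rightarrow> ('a \<Rightarrow> 'b) set" where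
  "operators E F = {T. lin_map E F T \<and> continuous_map (ntop E) (ntop F) T}"

definition opnorm :: "('k, 'a) normed \<Rightarrow> ('k, 'b) normed \<Rightarrow> ('a \<Rightarrow> 'b) \<Rightarrow> real" where
  "opnorm E F T = (SUP x \<in> {x \<in> carrier E. nrm E x \<le> 1}. nrm F (T x))"

definition finite_rank_operators :: "('k::real_normed_field, 'a) normed \<Rightarrow> ('a \<Rightarrow> 'a) set" where
  "finite_rank_operators E = {T \<in> operators E E. T ` carrier E \<in> FIN E}"

text \<open>
  The net of operators is represented by its eventuality filter. (Conversely, a proper filter
  as below is the eventuality filter of a net all of whose members satisfy the conditions.)
\<close>

definition bounded_approximation_property ::
    "real \<Rightarrow> ('k::real_normed_field, 'a) normed \<Rightarrow> bool" where
  "bounded_approximation_property lam E \<longleftrightarrow>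
     (\<exists>\<T> :: ('a \<Rightarrow> 'a) filter. \<T> \<noteq> bot \<and>
        (\<forall>\<^sub>F T in \<T>. T \<in> finite_rank_operators E \<and> opnorm E E T \<le> lam) \<and>
        (\<forall>C. compactin (ntop E) C \<longrightarrow>
           (\<forall>e>0. \<forall>\<^sub>F T in \<T>. \<forall>x\<in>C. nrm E (T x \<ominus>\<^bsub>E\<^esub> x) < e)))"


text \<open>
  The algebraic tensor power. An \<open>n\<close>-tuple is a list of length \<open>n\<close>, and
  \<open>x\<^sub>1 \<otimes> \<dots> \<otimes> x\<^sub>n\<close> is evaluation of \<open>n\<close>-linear forms at \<open>(x\<^sub>1, \<dots>, x\<^sub>n)\<close>;
  the tensor power is the span of these in the dual of the space of \<open>n\<close>-linear forms. Evaluation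
  at a function that is not an \<open>n\<close>-linear form is set to 0, so that tensors are equal as
  functions iff they agree on all \<open>n\<close>-linear forms.
\<close>

type_synonym ('k, 'a) tensor = "('a list \<Rightarrow> 'k) \<Rightarrow> 'k"

definition tuples :: "nat \<Rightarrow> ('k, 'a) normed \<Rightarrow> 'a list set" where
  "tuples n E = {xs. length xs = n \<and> set xs \<subseteq> carrier E}"

definition multilinear_form ::
    "nat \<Rightarrow> ('k::real_normed_field, 'a) normed \<Rightarrow> ('a list \<Rightarrow> 'k) \<Rightarrow> bool" where
  "multilinear_form n E \<phi> \<longleftrightarrow>
     (\<forall>xs\<in>tuples n E. \<forall>i<n. lin_map E scalars (\<lambda>a. \<phi> (xs[i := a])))"

definition pure_tensor ::
    "nat \<Rightarrow> ('k::real_normed_field, 'a) normed \<Rightarrow> 'a list \<Rightarrow> ('k, 'a) tensor" where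
  "pure_tensor n E xs = (\<lambda>\<phi>. if multilinear_form n E \<phi> then \<phi> xs else 0)"

definition tscale :: "'k::field \<Rightarrow> ('i \<Rightarrow> 'k) \<Rightarrow> 'i \<Rightarrow> 'k" where
  "tscale a f = (\<lambda>i. a * f i)"

global_interpretation tvs: vector_space "tscale :: 'k::field \<Rightarrow> ('i \<Rightarrow> 'k) \<Rightarrow> 'i \<Rightarrow> 'k"
  defines tspan = tvs.span
  by standard (simp_all add: tscale_def fun_eq_iff algebra_simps)

definition tensor_power :: "nat \<Rightarrow> ('k::real_normed_field, 'a) normed \<Rightarrow> ('k, 'a) tensor set" where
  "tensor_power n E = tspan (pure_tensor n E ` tuples n E)"

definition tpow ::
    "nat \<Rightarrow> ('k::real_normed_field, 'a) normed \<Rightarrow> 'a \<Rightarrow> ('k, 'a) tensor" where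
  "tpow n E x = pure_tensor n E (replicate n x)"

definition sym_tensor_power ::
    "nat \<Rightarrow> ('k::real_normed_field, 'a) normed \<Rightarrow> ('k, 'a) tensor set" where
  "sym_tensor_power n E = tspan (tpow n E ` carrier E)"

lemma sym_tensor_power_subset: "sym_tensor_power n E \<subseteq> tensor_power n E"
  unfolding sym_tensor_power_def tensor_power_def tpow_def
  by (rule tvs.span_mono) (auto simp: tuples_def)

definition represents ::
    "nat \<Rightarrow> ('k::real_normed_field, 'a) normed \<Rightarrow> ('k, 'a) tensor
      \<Rightarrow> nat \<Rightarrow> (nat \<Rightarrow> 'k) \<Rightarrow> (nat \<Rightarrow> 'a) \<Rightarrow> bool" where
  "represents n E z r l x \<longleftrightarrow>
     (\<forall>j<r. x j \<in> carrier E) \<and> z = (\<Sum>j<r. tscale (l j) (tpow n E (x j)))"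

definition pi_s :: "nat \<Rightarrow> ('k::real_normed_field, 'a) normed \<Rightarrow> ('k, 'a) tensor \<Rightarrow> real" where
  "pi_s n E z = Inf {\<Sum>j<r. norm (l j) * nrm E (x j) ^ n | r l x. represents n E z r l x}"

definition dual_ball :: "('k::real_normed_field, 'a) normed \<Rightarrow> ('a \<Rightarrow> 'k) set" where
  "dual_ball E = {x' \<in> operators E scalars. opnorm E scalars x' \<le> 1}"

text \<open>
  The sum \<open>\<Sum>\<^sub>j \<lambda>\<^sub>j x'(x\<^sub>j)\<^sup>n\<close> is the value of the tensor at the form
  \<open>(x\<^sub>1, \<dots>, x\<^sub>n) \<mapsto> x'(x\<^sub>1) \<cdots> x'(x\<^sub>n)\<close>; see \<open>eps_s_represents\<close> below.
\<close>

definition eps_s :: "nat \<Rightarrow> ('k::real_normed_field, 'a) normed \<Rightarrow> ('k, 'a) tensor \<Rightarrow> real" where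
  "eps_s n E z = (SUP x' \<in> dual_ball E. norm (z (\<lambda>xs. prod_list (map x' xs))))"

text \<open>Characterised by \<open>sym_map_add\<close>, \<open>sym_map_scale\<close> and \<open>sym_map_tpow\<close> below.\<close>

definition sym_map ::
    "nat \<Rightarrow> ('k::real_normed_field, 'b) normed \<Rightarrow> ('a \<Rightarrow> 'b) \<Rightarrow> ('k, 'a) tensor \<Rightarrow> ('k, 'b) tensor"
  where
  "sym_map n F T z = (\<lambda>\<psi>. if multilinear_form n F \<psi> then z (\<lambda>xs. \<psi> (map T xs)) else 0)"

text \<open>
  The normed spaces to which an s-tensor norm assigns a norm are all those with carrier in the
  type \<open>'a\<close>.
\<close>

definition s_tensor_norm ::
    "nat \<Rightarrow> (('k::real_normed_field, 'a) normed \<Rightarrow> ('k, 'a) tensor \<Rightarrow> real) \<Rightarrow> bool" where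
  "s_tensor_norm n \<alpha> \<longleftrightarrow>
     (\<forall>E. normed_space E \<longrightarrow>
        (\<forall>z\<in>sym_tensor_power n E. \<alpha> E z = 0 \<longleftrightarrow> z = 0) \<and>
        (\<forall>z\<in>sym_tensor_power n E. \<forall>w\<in>sym_tensor_power n E. \<alpha> E (z + w) \<le> \<alpha> E z + \<alpha> E w) \<and>
        (\<forall>a. \<forall>z\<in>sym_tensor_power n E. \<alpha> E (tscale a z) = norm a * \<alpha> E z) \<and>
        (\<forall>z\<in>sym_tensor_power n E. eps_s n E z \<le> \<alpha> E z \<and> \<alpha> E z \<le> pi_s n E z)) \<and>
     (\<forall>E F T. normed_space E \<and> normed_space F \<and> T \<in> operators E F \<longrightarrow>
        (\<forall>z\<in>sym_tensor_power n E. \<alpha> F (sym_map n F T z) \<le> opnorm E F T ^ n * \<alpha> E z))"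


lemma multilinear_form_prod:
  assumes "lin_map E scalars x'"
  shows "multilinear_form n E (\<lambda>xs. prod_list (map x' xs))"
proof -
  have upd: "prod_list (map x' (xs[i := a])) =
      prod_list (map x' (take i xs)) * x' a * prod_list (map x' (drop (Suc i) xs))"
    if "i < length xs" for xs i a
    using that by (simp add: upd_conv_take_nth_drop mult.assoc)
  show ?thesis
    using assms unfolding multilinear_form_def lin_map_def tuples_def
    by (auto simp: upd scalars_def algebra_simps)
qed

lemma multilinear_form_comp:
  assumes "lin_map E F T" "multilinear_form n F \<psi>"
  shows "multilinear_form n E (\<lambda>xs. \<psi> (map T xs))"
  unfolding multilinear_form_def
proof (intro ballI allI impI)
  fix xs i assume xs: "xs \<in> tuples n E" and i: "i < n"
  have "map T xs \<in> tuples n F"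
    using xs assms(1) by (auto simp: tuples_def lin_map_def Pi_iff subset_iff)
  then have "lin_map F scalars (\<lambda>b. \<psi> ((map T xs)[i := b]))"
    using assms(2) i by (simp add: multilinear_form_def)
  then show "lin_map E scalars (\<lambda>a. \<psi> (map T (xs[i := a])))"
    using assms(1) by (auto simp: lin_map_def map_update Pi_iff)
qed

lemma represents_apply:
  "represents n E z r l x \<Longrightarrow> z \<phi> = (\<Sum>j<r. l j * tpow n E (x j) \<phi>)"
proof -
  have "(\<Sum>j\<in>A. tscale (l j) (tpow n E (x j))) \<phi> = (\<Sum>j\<in>A. l j * tpow n E (x j) \<phi>)"
    for A :: "nat set"
    by (induction A rule: infinite_finite_induct) (simp_all add: tscale_def)
  then show "represents n E z r l x \<Longrightarrow> ?thesis"
    by (simp add: represents_def)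
qed

lemma sym_tensor_power_iff: "z \<in> sym_tensor_power n E \<longleftrightarrow> (\<exists>r l x. represents n E z r l x)"
proof
  assume "z \<in> sym_tensor_power n E"
  then obtain S u where S: "finite S" "S \<subseteq> tpow n E ` carrier E"
    and z: "z = (\<Sum>v\<in>S. tscale (u v) v)"
    unfolding sym_tensor_power_def tvs.span_explicit by blast
  obtain h where h: "bij_betw h {..<card S} S"
    using ex_bij_betw_nat_finite[OF S(1)] by (auto simp: atLeast0LessThan)
  have "\<forall>j\<in>{..<card S}. \<exists>y. y \<in> carrier E \<and> h j = tpow n E y"
  proof
    fix j assume "j \<in> {..<card S}"
    then have "h j \<in> tpow n E ` carrier E"
      using S(2) bij_betwE[OF h] by blast
    then show "\<exists>y. y \<in> carrier E \<and> h j = tpow n E y" by blast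
  qed
  then obtain x where x: "\<forall>j\<in>{..<card S}. x j \<in> carrier E \<and> h j = tpow n E (x j)"
    by (rule bchoice[THEN exE])
  have "z = (\<Sum>j<card S. tscale (u (h j)) (h j))"
    unfolding z by (rule sum.reindex_bij_betw[OF h, symmetric])
  also have "\<dots> = (\<Sum>j<card S. tscale (u (h j)) (tpow n E (x j)))"
    by (rule sum.cong) (simp_all add: x[rule_format])
  finally have "represents n E z (card S) (\<lambda>j. u (h j)) x"
    using x by (simp add: represents_def)
  then show "\<exists>r l x. represents n E z r l x" by blast
next
  assume "\<exists>r l x. represents n E z r l x"
  then obtain r l x where rep: "represents n E z r l x" by blast
  then have z: "z = (\<Sum>j<r. tscale (l j) (tpow n E (x j)))"
    and "\<forall>j<r. x j \<in> carrier E"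
    unfolding represents_def by simp_all
  then show "z \<in> sym_tensor_power n E"
    unfolding z sym_tensor_power_def
    by (intro tvs.span_sum tvs.span_scale tvs.span_base) auto
qed

lemma eps_s_represents:
  assumes "represents n E z r l x"
  shows "eps_s n E z = (SUP x' \<in> dual_ball E. norm (\<Sum>j<r. l j * x' (x j) ^ n))"
  unfolding eps_s_def
proof (intro SUP_cong refl)
  fix x' assume "x' \<in> dual_ball E"
  then have "multilinear_form n E (\<lambda>xs. prod_list (map x' xs))"
    by (intro multilinear_form_prod) (simp add: dual_ball_def operators_def)
  then show "norm (z (\<lambda>xs. prod_list (map x' xs))) = norm (\<Sum>j<r. l j * x' (x j) ^ n)"
    by (simp add: represents_apply[OF assms] tpow_def pure_tensor_def)
qed

lemma sym_map_add: "sym_map n F T (z + w) = sym_map n F T z + sym_map n F T w"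
  by (auto simp: sym_map_def)

lemma sym_map_scale: "sym_map n F T (tscale a z) = tscale a (sym_map n F T z)"
  by (auto simp: sym_map_def tscale_def)

lemma sym_map_tpow:
  assumes "lin_map E F T"
  shows "sym_map n F T (tpow n E x) = tpow n F (T x)"
  using multilinear_form_comp[OF assms]
  by (auto simp: sym_map_def tpow_def pure_tensor_def fun_eq_iff)

end

theory Submission
  imports Defs
begin

text \<open>
  Let \<open>z\<close> be a symmetric tensor over \<open>E\<close> and let \<open>T\<close> be a finite rank operator on \<open>E\<close> of norm at
  most \<open>\<lambda>\<close>. Its range lies in some subspace \<open>M\<close> of the cofinal family, so \<open>T\<close> factors as
  \<open>E \<rightarrow> M \<rightarrow> E\<close>, the corestriction having norm at most \<open>\<lambda>\<close> and the inclusion norm at most 1. The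
  mapping property of \<open>\<alpha>\<close> for the inclusion, the comparison on \<open>M\<close> and the mapping property of
  \<open>\<beta>\<close> for the corestriction give \<open>\<alpha> ((\<otimes>\<^sup>n T) z) \<le> \<lambda>\<^sup>n c \<beta> z\<close>; this is
  \<open>s_tensor_norm_compare_through_subspace\<close>.

  It remains to see that \<open>\<alpha> (z - (\<otimes>\<^sup>n T) z)\<close> becomes small as \<open>T\<close> runs through an approximating
  net (\<open>s_tensor_norm_sym_map_close\<close>). A representation of \<open>z\<close> involves only finitely many
  vectors, which form a compact set, and \<open>\<alpha> \<le> \<pi>\<^sub>s\<close>; hence it suffices that \<open>x \<mapsto> \<otimes>\<^sup>n x\<close> is
  continuous for \<open>\<pi>\<^sub>s\<close> (\<open>pi_s_tpow_continuous\<close>). The point is that \<open>\<pi>\<^sub>s\<close> only admits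
  representations by symmetric powers, so that the mixed terms in the expansion of
  \<open>\<otimes>\<^sup>n (x + h)\<close> cannot be estimated one by one. Instead, \<open>s \<mapsto> \<otimes>\<^sup>n (x + s u)\<close> is polynomial of
  degree at most \<open>n\<close>, and Lagrange interpolation at the nodes \<open>0, \<dots>, n\<close> writes its values as
  combinations of symmetric powers with coefficients depending continuously on \<open>s\<close>.
\<close>

section \<open>Normed spaces and their subspaces\<close>

lemma scalars_simps [simp]:
  "carrier scalars = UNIV" "\<zero>\<^bsub>scalars\<^esub> = 0" "\<one>\<^bsub>scalars\<^esub> = 1"
  "x \<oplus>\<^bsub>scalars\<^esub> y = x + y" "x \<otimes>\<^bsub>scalars\<^esub> y = x * y" "x \<odot>\<^bsub>scalars\<^esub> y = x * y"
  "nrm scalars x = norm x"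
  by (simp_all add: scalars_def)

context normed_space
begin

lemma smult_in_carrier [simp]: "x \<in> carrier E \<Longrightarrow> a \<odot>\<^bsub>E\<^esub> x \<in> carrier E"
  using smult_closed[of a x] by simp

lemma smult_distrib_left: "x \<in> carrier E \<Longrightarrow> (a + b) \<odot>\<^bsub>E\<^esub> x = a \<odot>\<^bsub>E\<^esub> x \<oplus>\<^bsub>E\<^esub> b \<odot>\<^bsub>E\<^esub> x"
  using smult_l_distr[of a b x] by simp

lemma smult_smult: "x \<in> carrier E \<Longrightarrow> a \<odot>\<^bsub>E\<^esub> (b \<odot>\<^bsub>E\<^esub> x) = (a * b) \<odot>\<^bsub>E\<^esub> x"
  using smult_assoc1[of a b x] by simp

lemma smult_1 [simp]: "x \<in> carrier E \<Longrightarrow> 1 \<odot>\<^bsub>E\<^esub> x = x"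
  using smult_one[of x] by simp

lemma smult_0 [simp]: "x \<in> carrier E \<Longrightarrow> 0 \<odot>\<^bsub>E\<^esub> x = \<zero>\<^bsub>E\<^esub>"
  using smult_l_null[of x] by simp

lemma minus_eq_smult:
  assumes "x \<in> carrier E" shows "\<ominus>\<^bsub>E\<^esub> x = (- 1) \<odot>\<^bsub>E\<^esub> x"
proof (rule M.minus_equality)
  show "(- 1) \<odot>\<^bsub>E\<^esub> x \<oplus>\<^bsub>E\<^esub> x = \<zero>\<^bsub>E\<^esub>"
    using smult_distrib_left[of x "- 1" 1] assms by simp
qed (use assms in auto)

lemma nrm_zero [simp]: "nrm E \<zero>\<^bsub>E\<^esub> = 0"
  by (simp add: nrm_eq_0)

lemma nrm_uminus: "x \<in> carrier E \<Longrightarrow> nrm E (\<ominus>\<^bsub>E\<^esub> x) = nrm E x"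
  by (simp add: minus_eq_smult nrm_smult)

lemma nrm_nonneg:
  assumes "x \<in> carrier E" shows "0 \<le> nrm E x"
proof -
  have "nrm E (x \<oplus>\<^bsub>E\<^esub> (\<ominus>\<^bsub>E\<^esub> x)) \<le> nrm E x + nrm E (\<ominus>\<^bsub>E\<^esub> x)"
    using assms by (intro nrm_add) auto
  with assms show ?thesis by (simp add: nrm_uminus M.r_neg)
qed

lemma nrm_minus_commute:
  assumes "x \<in> carrier E" "y \<in> carrier E"
  shows "nrm E (x \<ominus>\<^bsub>E\<^esub> y) = nrm E (y \<ominus>\<^bsub>E\<^esub> x)"
proof -
  have "\<ominus>\<^bsub>E\<^esub> (x \<ominus>\<^bsub>E\<^esub> y) = y \<ominus>\<^bsub>E\<^esub> x"
    using assms by (simp add: a_minus_def M.minus_add M.a_comm)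
  with assms show ?thesis by (metis nrm_uminus M.minus_closed)
qed

lemma diff_add_diff:
  assumes "x \<in> carrier E" "y \<in> carrier E" "z \<in> carrier E"
  shows "x \<ominus>\<^bsub>E\<^esub> z = (x \<ominus>\<^bsub>E\<^esub> y) \<oplus>\<^bsub>E\<^esub> (y \<ominus>\<^bsub>E\<^esub> z)"
  using assms by (simp add: a_minus_def M.a_assoc M.r_neg1)

lemma diff_eq_zero_iff:
  assumes "x \<in> carrier E" "y \<in> carrier E"
  shows "x \<ominus>\<^bsub>E\<^esub> y = \<zero>\<^bsub>E\<^esub> \<longleftrightarrow> x = y"
proof
  assume "x \<ominus>\<^bsub>E\<^esub> y = \<zero>\<^bsub>E\<^esub>"
  then have "\<ominus>\<^bsub>E\<^esub> (\<ominus>\<^bsub>E\<^esub> y) = x"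
    using assms by (intro M.minus_equality) (simp_all add: a_minus_def)
  then show "x = y" using assms by simp
qed (use assms in \<open>simp add: a_minus_def M.r_neg\<close>)

lemma Metric_space_ndist: "Metric_space (carrier E) (ndist E)"
proof
  show "0 \<le> ndist E x y" for x y
    by (simp add: ndist_def nrm_nonneg)
  show "ndist E x y = ndist E y x" for x y
    by (simp add: ndist_def nrm_minus_commute)
  show "ndist E x y = 0 \<longleftrightarrow> x = y" if "x \<in> carrier E" "y \<in> carrier E" for x y
    using that by (simp add: ndist_def nrm_eq_0 diff_eq_zero_iff)
  show "ndist E x z \<le> ndist E x y + ndist E y z"
    if "x \<in> carrier E" "y \<in> carrier E" "z \<in> carrier E" for x y z
    using that by (simp add: ndist_def diff_add_diff[of x y z] nrm_add)
qed

lemma normed_subspace: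
  assumes "submodule M scalars E"
  shows "normed_space (E\<lparr>carrier := M\<rparr>)"
proof -
  have "Module.module scalars (E\<lparr>carrier := M\<rparr>)"
    using submodule.submodule_is_module[OF assms module_axioms] .
  then show ?thesis
    using submoduleE(1)[OF assms]
    by (auto simp: normed_space_def normed_space_axioms_def nrm_eq_0 nrm_add nrm_smult subset_iff)
qed

end

section \<open>Bounded operators\<close>

lemma lin_map_diff:
  assumes "normed_space E" "normed_space F" "lin_map E F T" "x \<in> carrier E" "y \<in> carrier E"
  shows "T (x \<ominus>\<^bsub>E\<^esub> y) = T x \<ominus>\<^bsub>F\<^esub> T y"
proof -
  interpret E: normed_space E by fact
  interpret F: normed_space F by fact
  show ?thesis
    using assms(3-5)
    by (auto simp: a_minus_def lin_map_def E.minus_eq_smult F.minus_eq_smult Pi_iff)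
qed

lemma lin_map_zero:
  assumes "normed_space E" "normed_space F" "lin_map E F T"
  shows "T \<zero>\<^bsub>E\<^esub> = \<zero>\<^bsub>F\<^esub>"
proof -
  interpret E: normed_space E by fact
  interpret F: normed_space F by fact
  have "T (0 \<odot>\<^bsub>E\<^esub> \<zero>\<^bsub>E\<^esub>) = 0 \<odot>\<^bsub>F\<^esub> T \<zero>\<^bsub>E\<^esub>"
    using assms(3) E.M.zero_closed unfolding lin_map_def by blast
  moreover have "T \<zero>\<^bsub>E\<^esub> \<in> carrier F"
    using assms(3) E.M.zero_closed unfolding lin_map_def by blast
  ultimately show ?thesis by simp
qed

text \<open>
  Boundedness, unlike continuity, does not mention the topologies, so it passes to corestrictions
  and inclusions of subspaces without further thought.
\<close>

lemma operators_iff_bounded: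
  fixes E :: "('k::real_normed_field, 'a) normed"
  assumes "normed_space E" "normed_space F" "lin_map E F T"
  shows "T \<in> operators E F \<longleftrightarrow> (\<exists>K. \<forall>x\<in>carrier E. nrm F (T x) \<le> K * nrm E x)"
proof -
  interpret E: normed_space E by fact
  interpret F: normed_space F by fact
  have closed: "T x \<in> carrier F" if "x \<in> carrier E" for x
    using that assms(3) by (auto simp: lin_map_def)
  have smult: "T (a \<odot>\<^bsub>E\<^esub> x) = a \<odot>\<^bsub>F\<^esub> T x" if "x \<in> carrier E" for a x
    using that assms(3) by (auto simp: lin_map_def)
  note cont_iff = Metric_space.metric_continuous_map[OF E.Metric_space_ndist F.Metric_space_ndist, of T]
  show ?thesis
  proof
    assume "T \<in> operators E F"
    then have "continuous_map (ntop E) (ntop F) T"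
      by (simp add: operators_def)
    then obtain d where d: "d > 0"
      and *: "\<And>x. x \<in> carrier E \<Longrightarrow> ndist E \<zero>\<^bsub>E\<^esub> x < d \<Longrightarrow> ndist F (T \<zero>\<^bsub>E\<^esub>) (T x) < 1"
      using E.M.zero_closed zero_less_one unfolding ntop_def cont_iff by meson
    have small: "nrm F (T x) < 1" if "x \<in> carrier E" "nrm E x < d" for x
      using *[of x] that closed[of x] lin_map_zero[OF assms]
      by (simp add: ndist_def a_minus_def E.nrm_uminus F.nrm_uminus)
    have "nrm F (T x) \<le> 2 / d * nrm E x" if x: "x \<in> carrier E" for x
    proof (cases "nrm E x = 0")
      case True
      then have "x = \<zero>\<^bsub>E\<^esub>" using x by (simp add: E.nrm_eq_0)
      then show ?thesis by (simp add: lin_map_zero[OF assms])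
    next
      case False
      then have pos: "0 < nrm E x" using E.nrm_nonneg[OF x] by simp
      define a :: 'k where "a = of_real (d / (2 * nrm E x))"
      have a: "norm a = d / (2 * nrm E x)"
        using d pos by (simp add: a_def norm_divide)
      have "nrm F (T (a \<odot>\<^bsub>E\<^esub> x)) < 1"
        using x d pos by (intro small) (simp_all add: E.nrm_smult a)
      then show ?thesis
        using x d pos closed by (simp add: smult F.nrm_smult a field_simps)
    qed
    then show "\<exists>K. \<forall>x\<in>carrier E. nrm F (T x) \<le> K * nrm E x" by blast
  next
    assume "\<exists>K. \<forall>x\<in>carrier E. nrm F (T x) \<le> K * nrm E x"
    then obtain K where K: "\<And>x. x \<in> carrier E \<Longrightarrow> nrm F (T x) \<le> K * nrm E x" by blast
    have bound: "ndist F (T x) (T y) \<le> (\<bar>K\<bar> + 1) * ndist E x y"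
      if "x \<in> carrier E" "y \<in> carrier E" for x y
    proof -
      have "nrm F (T (x \<ominus>\<^bsub>E\<^esub> y)) \<le> K * nrm E (x \<ominus>\<^bsub>E\<^esub> y)"
        using that by (intro K) auto
      also have "\<dots> \<le> (\<bar>K\<bar> + 1) * nrm E (x \<ominus>\<^bsub>E\<^esub> y)"
        using that by (intro mult_right_mono E.nrm_nonneg) auto
      finally show ?thesis
        using that closed by (simp add: ndist_def lin_map_diff[OF assms])
    qed
    have "\<exists>d>0. \<forall>y. y \<in> carrier E \<and> ndist E x y < d \<longrightarrow> ndist F (T x) (T y) < e"
      if "x \<in> carrier E" "e > 0" for x e
    proof (intro exI conjI allI impI)
      show "0 < e / (\<bar>K\<bar> + 1)" using that by simp
      fix y assume y: "y \<in> carrier E \<and> ndist E x y < e / (\<bar>K\<bar> + 1)"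
      then have "(\<bar>K\<bar> + 1) * ndist E x y < e"
        by (simp add: pos_less_divide_eq mult.commute)
      with bound[of x y] y that show "ndist F (T x) (T y) < e" by auto
    qed
    then show "T \<in> operators E F"
      using closed assms(3) unfolding operators_def ntop_def mem_Collect_eq cont_iff by blast
  qed
qed

text \<open>
  The supremum over an unbounded set of reals is an unspecified number, so that already
  nonnegativity of the operator norm rests on boundedness.
\<close>

lemma opnorm_nonneg:
  assumes "normed_space E" "normed_space F" "T \<in> operators E F"
  shows "0 \<le> opnorm E F T"
proof -
  interpret E: normed_space E by fact
  interpret F: normed_space F by fact
  have lin: "lin_map E F T" using assms(3) by (simp add: operators_def)
  obtain K where K: "\<And>x. x \<in> carrier E \<Longrightarrow> nrm F (T x) \<le> K * nrm E x"
    using assms(3) operators_iff_bounded[OF assms(1,2) lin] by blast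
  have "nrm F (T x) \<le> \<bar>K\<bar>" if "x \<in> carrier E" "nrm E x \<le> 1" for x
  proof -
    have "K * nrm E x \<le> \<bar>K\<bar> * 1"
      using that E.nrm_nonneg[of x] by (intro mult_mono) auto
    with K[OF that(1)] show ?thesis by simp
  qed
  then have "bdd_above ((\<lambda>x. nrm F (T x)) ` {x \<in> carrier E. nrm E x \<le> 1})"
    by (intro bdd_aboveI[of _ "\<bar>K\<bar>"]) auto
  then have "nrm F (T \<zero>\<^bsub>E\<^esub>) \<le> opnorm E F T"
    unfolding opnorm_def by (intro cSUP_upper) auto
  then show ?thesis by (simp add: lin_map_zero[OF assms(1,2) lin])
qed

lemma corestriction_in_operators:
  assumes "normed_space E" "submodule M scalars E" "T \<in> operators E E" "T ` carrier E \<subseteq> M"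
  shows "T \<in> operators E (E\<lparr>carrier := M\<rparr>)"
proof -
  note EM = normed_space.normed_subspace[OF assms(1,2)]
  have lin: "lin_map E E T" using assms(3) by (simp add: operators_def)
  then have "lin_map E (E\<lparr>carrier := M\<rparr>) T"
    using assms(4) by (auto simp: lin_map_def)
  then show ?thesis
    using assms(3) operators_iff_bounded[OF assms(1,1) lin] operators_iff_bounded[OF assms(1) EM]
    by simp
qed

lemma inclusion_operator:
  assumes "normed_space E" "submodule M scalars E"
  shows "(\<lambda>x. x) \<in> operators (E\<lparr>carrier := M\<rparr>) E" "opnorm (E\<lparr>carrier := M\<rparr>) E (\<lambda>x. x) \<le> 1"
proof -
  interpret E: normed_space E by fact
  note EM = E.normed_subspace[OF assms(2)]
  interpret EM: normed_space "E\<lparr>carrier := M\<rparr>" by (rule EM)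
  have "lin_map (E\<lparr>carrier := M\<rparr>) E (\<lambda>x. x)"
    using E.submoduleE(1)[OF assms(2)] by (auto simp: lin_map_def)
  then show "(\<lambda>x. x) \<in> operators (E\<lparr>carrier := M\<rparr>) E"
    by (subst operators_iff_bounded[OF EM assms(1)]) (auto intro: exI[of _ 1])
  have "\<zero>\<^bsub>E\<^esub> \<in> M" "nrm E \<zero>\<^bsub>E\<^esub> \<le> 1" using EM.M.zero_closed by simp_all
  then show "opnorm (E\<lparr>carrier := M\<rparr>) E (\<lambda>x. x) \<le> 1"
    unfolding opnorm_def by (intro cSUP_least) auto
qed

section \<open>Interpolating symmetric powers along a line\<close>

definition lagrange_poly :: "nat \<Rightarrow> nat \<Rightarrow> 'k::field_char_0 poly" where
  "lagrange_poly n i =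
     (\<Prod>j\<in>{..n} - {i}. Polynomial.smult (inverse (of_nat i - of_nat j)) [:- of_nat j, 1:])"

lemma degree_lagrange_poly: "i \<le> n \<Longrightarrow> degree (lagrange_poly n i) \<le> n"
proof -
  assume "i \<le> n"
  have "degree (lagrange_poly n i :: 'a poly) \<le>
      (\<Sum>j\<in>{..n} - {i}.
        degree (Polynomial.smult (inverse (of_nat i - of_nat j)) [:- of_nat j, 1 :: 'a:]))"
    unfolding lagrange_poly_def by (rule degree_prod_sum_le[unfolded o_def]) simp
  also have "\<dots> \<le> (\<Sum>j\<in>{..n} - {i}. 1)"
    by (intro sum_mono) simp
  finally show ?thesis using \<open>i \<le> n\<close> by simp
qed

lemma poly_lagrange_poly_node:
  fixes i k n :: nat
  assumes "i \<le> n" "k \<le> n"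
  shows "poly (lagrange_poly n i) (of_nat k) = (if i = k then 1 else (0 :: 'a :: field_char_0))"
proof (cases "i = k")
  case True
  have "poly (Polynomial.smult (inverse (of_nat k - of_nat j)) [:- of_nat j, 1:]) (of_nat k) = (1 :: 'a)"
    if "j \<in> {..n} - {k}" for j
  proof -
    have "of_nat k - of_nat j \<noteq> (0 :: 'a)" using that by auto
    then have "inverse (of_nat k - of_nat j) * (of_nat k - of_nat j) = (1 :: 'a)"
      by (rule left_inverse)
    then show ?thesis by (simp add: algebra_simps)
  qed
  then have "(\<Prod>j\<in>{..n} - {k}.
      poly (Polynomial.smult (inverse (of_nat k - of_nat j)) [:- of_nat j, 1:]) (of_nat k)) = (1 :: 'a)"
    by (intro prod.neutral) blast
  then show ?thesis
    by (simp only: True lagrange_poly_def poly_prod if_True simp_thms)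
next
  case False
  then have "k \<in> {..n} - {i}" using assms by simp
  then show ?thesis
    using False by (auto simp: lagrange_poly_def poly_prod intro!: prod_zero)
qed

lemma lagrange_interpolation:
  fixes p :: "'k::field_char_0 poly"
  assumes "degree p \<le> n"
  shows "poly p s = (\<Sum>i<Suc n. poly (lagrange_poly n i) s * poly p (of_nat i))"
proof -
  define q where "q = (\<Sum>i<Suc n. Polynomial.smult (poly p (of_nat i)) (lagrange_poly n i))"
  have "p = q"
  proof (rule poly_eqI_degree)
    show "poly p x = poly q x" if "x \<in> of_nat ` {..n}" for x
      using that
      by (auto simp: q_def poly_sum poly_lagrange_poly_node lessThan_Suc_atMost if_distrib
               cong: if_cong)
    have card: "card (of_nat ` {..n} :: 'k set) = Suc n"
      by (subst card_image) (auto simp: inj_on_def)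
    show "degree p < card (of_nat ` {..n} :: 'k set)"
      using assms card by simp
    have "degree q \<le> n"
      unfolding q_def
      by (intro degree_sum_le) (auto intro!: order.trans[OF degree_smult_le] degree_lagrange_poly)
    then show "degree q < card (of_nat ` {..n} :: 'k set)"
      using card by simp
  qed
  then have "poly p s = poly q s" by (rule arg_cong)
  also have "\<dots> = (\<Sum>i<Suc n. poly (lagrange_poly n i) s * poly p (of_nat i))"
    unfolding q_def by (simp add: poly_sum mult.commute del: sum.lessThan_Suc)
  finally show ?thesis .
qed

text \<open>
  Expanding one entry \<open>x + s u\<close> by linearity leaves two values with one varying entry less, the
  second of them multiplied by \<open>s\<close>. The prefix \<open>ys\<close> collects the entries \<open>x\<close> or \<open>u\<close> that replace
  the expanded ones, so that the induction runs over the number of varying entries.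
\<close>

lemma multilinear_form_line_poly:
  assumes "multilinear_form n E \<phi>" "normed_space E" "x \<in> carrier E" "u \<in> carrier E"
    and "set ys \<subseteq> carrier E" "length ys + k = n"
  shows "\<exists>p. degree p \<le> k \<and> (\<forall>s. \<phi> (ys @ replicate k (x \<oplus>\<^bsub>E\<^esub> s \<odot>\<^bsub>E\<^esub> u)) = poly p s)"
  using assms(5,6)
proof (induction k arbitrary: ys)
  case 0
  then show ?case by (intro exI[of _ "[:\<phi> ys:]"]) simp
next
  case (Suc k)
  interpret E: normed_space E by fact
  obtain p where p: "degree p \<le> k"
      "\<And>s. \<phi> ((ys @ [x]) @ replicate k (x \<oplus>\<^bsub>E\<^esub> s \<odot>\<^bsub>E\<^esub> u)) = poly p s"
    using Suc.IH[of "ys @ [x]"] Suc.prems assms(3) by auto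
  obtain q where q: "degree q \<le> k"
      "\<And>s. \<phi> ((ys @ [u]) @ replicate k (x \<oplus>\<^bsub>E\<^esub> s \<odot>\<^bsub>E\<^esub> u)) = poly q s"
    using Suc.IH[of "ys @ [u]"] Suc.prems assms(4) by auto
  have "\<phi> (ys @ replicate (Suc k) (x \<oplus>\<^bsub>E\<^esub> s \<odot>\<^bsub>E\<^esub> u)) = poly (p + pCons 0 q) s" for s
  proof -
    let ?R = "replicate k (x \<oplus>\<^bsub>E\<^esub> s \<odot>\<^bsub>E\<^esub> u)"
    have "ys @ x # ?R \<in> tuples n E" "length ys < n"
      using Suc.prems assms(3,4) by (auto simp: tuples_def)
    then have "lin_map E scalars (\<lambda>a. \<phi> ((ys @ x # ?R)[length ys := a]))"
      using assms(1) unfolding multilinear_form_def by blast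
    then have lin: "lin_map E scalars (\<lambda>a. \<phi> (ys @ a # ?R))" by simp
    have "\<phi> (ys @ (x \<oplus>\<^bsub>E\<^esub> s \<odot>\<^bsub>E\<^esub> u) # ?R) = \<phi> (ys @ x # ?R) + s * \<phi> (ys @ u # ?R)"
      using lin assms(3,4) by (simp add: lin_map_def)
    then show ?thesis using p(2)[of s] q(2)[of s] by simp
  qed
  moreover have "degree (p + pCons 0 q) \<le> Suc k"
    using p(1) q(1) by (intro degree_add_le) (auto intro: order.trans[OF degree_pCons_le])
  ultimately show ?case by blast
qed

lemma sum_fun_apply: "(\<Sum>i\<in>A. f i) x = (\<Sum>i\<in>A. f i x)"
  by (induction A rule: infinite_finite_induct) simp_all

lemma tpow_line_interpolation:
  assumes "normed_space E" "x \<in> carrier E" "u \<in> carrier E"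
  shows "tpow n E (x \<oplus>\<^bsub>E\<^esub> s \<odot>\<^bsub>E\<^esub> u) =
    (\<Sum>i<Suc n. tscale (poly (lagrange_poly n i) s) (tpow n E (x \<oplus>\<^bsub>E\<^esub> of_nat i \<odot>\<^bsub>E\<^esub> u)))"
proof
  fix \<phi>
  show "tpow n E (x \<oplus>\<^bsub>E\<^esub> s \<odot>\<^bsub>E\<^esub> u) \<phi> =
    (\<Sum>i<Suc n. tscale (poly (lagrange_poly n i) s) (tpow n E (x \<oplus>\<^bsub>E\<^esub> of_nat i \<odot>\<^bsub>E\<^esub> u))) \<phi>"
  proof (cases "multilinear_form n E \<phi>")
    case True
    then obtain p where p: "degree p \<le> n"
        "\<And>s. \<phi> (replicate n (x \<oplus>\<^bsub>E\<^esub> s \<odot>\<^bsub>E\<^esub> u)) = poly p s"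
      using multilinear_form_line_poly[OF True assms, of "[]" n] by auto
    show ?thesis
      using True by (simp only: sum_fun_apply tscale_def tpow_def pure_tensor_def p(2) if_True
          lagrange_interpolation[OF p(1), of s])
  next
    case False
    then show ?thesis by (simp add: sum_fun_apply tscale_def tpow_def pure_tensor_def)
  qed
qed

section \<open>Continuity of the symmetric power\<close>

lemma pi_s_le:
  assumes "normed_space E" "represents n E z r l x"
  shows "pi_s n E z \<le> (\<Sum>j<r. norm (l j) * nrm E (x j) ^ n)"
  unfolding pi_s_def
proof (rule cInf_lower)
  show "bdd_below {\<Sum>j<r. norm (l j) * nrm E (x j) ^ n | r l x. represents n E z r l x}"
    using assms(1)
    by (intro bdd_belowI[of _ 0])
      (auto simp: represents_def intro!: sum_nonneg mult_nonneg_nonneg zero_le_power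
        normed_space.nrm_nonneg)
qed (use assms(2) in blast)

text \<open>
  Writing \<open>y = x + d u\<close> with \<open>d\<close> small and \<open>u\<close> in the unit ball, Lagrange interpolation expresses
  \<open>\<otimes>\<^sup>n y - \<otimes>\<^sup>n x\<close> as a combination of the \<open>\<otimes>\<^sup>n (x + i u)\<close>, \<open>i \<le> n\<close>, with coefficients
  \<open>L\<^sub>i(d) - L\<^sub>i(0)\<close>. This is a representation by symmetric powers, and its coefficients
  tend to 0 while its vectors stay bounded.
\<close>

lemma pi_s_tpow_continuous:
  fixes E :: "('k::real_normed_field, 'a) normed"
  assumes "normed_space E" "x \<in> carrier E" "e > 0"
  shows "\<exists>d>0. \<forall>y\<in>carrier E. nrm E (y \<ominus>\<^bsub>E\<^esub> x) < d \<longrightarrow> pi_s n E (tpow n E y - tpow n E x) < e"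
proof -
  interpret E: normed_space E by fact
  define L :: "nat \<Rightarrow> 'k \<Rightarrow> 'k" where "L = (\<lambda>i. poly (lagrange_poly n i))"
  define g where
    "g = (\<lambda>s. \<Sum>i<Suc n. norm (L i s - L i 0) * (nrm E x + real i) ^ n)"
  have "isCont g 0"
    unfolding g_def L_def by (intro continuous_intros)
  moreover have "g 0 = 0" by (simp add: g_def)
  ultimately obtain d where d: "d > 0" "\<And>s. norm s < d \<Longrightarrow> g s < e"
    using \<open>e > 0\<close> unfolding continuous_at_eps_delta
    by (metis abs_ge_self diff_zero dist_norm le_less_trans real_norm_def)
  define t :: 'k where "t = of_real (d / 2)"
  have norm_t: "norm t = d / 2" and t0: "t \<noteq> 0"
    using d(1) by (simp_all add: t_def)
  have "pi_s n E (tpow n E y - tpow n E x) < e"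
    if y: "y \<in> carrier E" and close: "nrm E (y \<ominus>\<^bsub>E\<^esub> x) < d / 2" for y
  proof -
    define u where "u = inverse t \<odot>\<^bsub>E\<^esub> (y \<ominus>\<^bsub>E\<^esub> x)"
    have u: "u \<in> carrier E" using y assms(2) by (simp add: u_def)
    have nrm_u: "nrm E u \<le> 1"
      using y assms(2) close d(1)
      by (simp add: u_def E.nrm_smult norm_inverse norm_t pos_divide_le_eq)
    have "x \<oplus>\<^bsub>E\<^esub> t \<odot>\<^bsub>E\<^esub> u = x \<oplus>\<^bsub>E\<^esub> (y \<ominus>\<^bsub>E\<^esub> x)"
      using y assms(2) t0 by (simp add: u_def E.smult_smult)
    also have "\<dots> = y"
      using y assms(2) by (simp add: a_minus_def E.M.a_lcomm[of x y] E.M.r_neg)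
    finally have yx: "y = x \<oplus>\<^bsub>E\<^esub> t \<odot>\<^bsub>E\<^esub> u" by simp
    have xx: "x = x \<oplus>\<^bsub>E\<^esub> 0 \<odot>\<^bsub>E\<^esub> u" using assms(2) u by simp
    let ?v = "\<lambda>i. x \<oplus>\<^bsub>E\<^esub> of_nat i \<odot>\<^bsub>E\<^esub> u"
    have "tpow n E y = (\<Sum>i<Suc n. tscale (L i t) (tpow n E (?v i)))"
      unfolding L_def by (subst yx) (rule tpow_line_interpolation[OF assms(1,2) u])
    moreover have "tpow n E x = (\<Sum>i<Suc n. tscale (L i 0) (tpow n E (?v i)))"
      unfolding L_def by (subst xx) (rule tpow_line_interpolation[OF assms(1,2) u])
    ultimately have "tpow n E y - tpow n E x =
        (\<Sum>i<Suc n. tscale (L i t - L i 0) (tpow n E (?v i)))"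
      by (simp only: tvs.scale_left_diff_distrib sum_subtractf)
    then have "represents n E (tpow n E y - tpow n E x) (Suc n) (\<lambda>i. L i t - L i 0) ?v"
      using assms(2) u by (simp add: represents_def)
    then have "pi_s n E (tpow n E y - tpow n E x)
        \<le> (\<Sum>i<Suc n. norm (L i t - L i 0) * nrm E (?v i) ^ n)"
      by (rule pi_s_le[OF assms(1)])
    also have "\<dots> \<le> g t"
      unfolding g_def
    proof (intro sum_mono mult_left_mono power_mono)
      fix i
      have "nrm E (?v i) \<le> nrm E x + real i * nrm E u"
        using E.nrm_add[of x "of_nat i \<odot>\<^bsub>E\<^esub> u"] assms(2) u by (simp add: E.nrm_smult)
      also have "\<dots> \<le> nrm E x + real i"
        using nrm_u by (simp add: mult_left_le)
      finally show "nrm E (?v i) \<le> nrm E x + real i" .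
      show "0 \<le> nrm E (?v i)"
        using assms(2) u by (intro E.nrm_nonneg) simp
    qed simp
    also have "\<dots> < e" using norm_t d by simp
    finally show ?thesis .
  qed
  then show ?thesis using d(1) half_gt_zero by blast
qed

section \<open>Tensor norms\<close>

lemma represents_sym_map:
  assumes "lin_map E F T" "represents n E z r l x"
  shows "represents n F (sym_map n F T z) r l (\<lambda>j. T (x j))"
proof -
  have "sym_map n F T 0 = 0"
    by (simp add: sym_map_def fun_eq_iff)
  then have "sym_map n F T (\<Sum>j\<in>A. tscale (l j) (tpow n E (x j)))
      = (\<Sum>j\<in>A. tscale (l j) (tpow n F (T (x j))))" for A :: "nat set"
    by (induction A rule: infinite_finite_induct)
      (simp_all add: sym_map_add sym_map_scale sym_map_tpow[OF assms(1)])
  then show ?thesis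
    using assms by (auto simp: represents_def lin_map_def)
qed

lemma s_tensor_norm_zero:
  assumes "s_tensor_norm n \<alpha>" "normed_space E"
  shows "\<alpha> E 0 = 0"
proof -
  have "0 \<in> sym_tensor_power n E"
    unfolding sym_tensor_power_def by (rule tvs.span_zero)
  then show ?thesis
    using assms(1)[unfolded s_tensor_norm_def, THEN conjunct1, rule_format, OF assms(2)] by blast
qed

lemma s_tensor_norm_scale:
  assumes "s_tensor_norm n \<alpha>" "normed_space E" "z \<in> sym_tensor_power n E"
  shows "\<alpha> E (tscale a z) = norm a * \<alpha> E z"
  using assms(1)[unfolded s_tensor_norm_def, THEN conjunct1, rule_format, OF assms(2)] assms(3)
  by blast

lemma s_tensor_norm_triangle:
  assumes "s_tensor_norm n \<alpha>" "normed_space E"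
    and "z \<in> sym_tensor_power n E" "w \<in> sym_tensor_power n E"
  shows "\<alpha> E (z + w) \<le> \<alpha> E z + \<alpha> E w"
  using assms(1)[unfolded s_tensor_norm_def, THEN conjunct1, rule_format, OF assms(2)] assms(3,4)
  by blast

lemma s_tensor_norm_le_pi_s:
  assumes "s_tensor_norm n \<alpha>" "normed_space E" "z \<in> sym_tensor_power n E"
  shows "\<alpha> E z \<le> pi_s n E z"
  using assms(1)[unfolded s_tensor_norm_def, THEN conjunct1, rule_format, OF assms(2)] assms(3)
  by blast

lemma s_tensor_norm_nonneg:
  fixes E :: "('k::real_normed_field, 'a) normed"
  assumes "s_tensor_norm n \<alpha>" "normed_space E" "z \<in> sym_tensor_power n E"
  shows "0 \<le> \<alpha> E z"
proof -
  have neg: "tscale (- 1) z \<in> sym_tensor_power n E"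
    using assms(3) unfolding sym_tensor_power_def by (rule tvs.span_scale)
  have "z + tscale (- 1) z = 0"
    by (simp add: tscale_def fun_eq_iff)
  moreover have "\<alpha> E (z + tscale (- 1) z) \<le> \<alpha> E z + \<alpha> E (tscale (- 1) z)"
    by (rule s_tensor_norm_triangle[OF assms neg])
  moreover have "\<alpha> E (tscale (- 1) z) = norm (- 1 :: 'k) * \<alpha> E z"
    by (rule s_tensor_norm_scale[OF assms])
  ultimately show ?thesis
    using s_tensor_norm_zero[OF assms(1,2)] by simp
qed

lemma s_tensor_norm_sum_le:
  assumes "s_tensor_norm n \<alpha>" "normed_space E" "finite A"
    and "\<And>j. j \<in> A \<Longrightarrow> w j \<in> sym_tensor_power n E"
  shows "\<alpha> E (\<Sum>j\<in>A. tscale (l j) (w j)) \<le> (\<Sum>j\<in>A. norm (l j) * \<alpha> E (w j))"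
  using assms(3,4)
proof (induction A)
  case empty
  show ?case
    unfolding sum.empty s_tensor_norm_zero[OF assms(1,2)] ..
next
  case (insert i A)
  have "tscale (l i) (w i) \<in> sym_tensor_power n E"
    "(\<Sum>j\<in>A. tscale (l j) (w j)) \<in> sym_tensor_power n E"
    using insert.prems unfolding sym_tensor_power_def
    by (auto intro!: tvs.span_sum tvs.span_scale)
  then have "\<alpha> E (tscale (l i) (w i) + (\<Sum>j\<in>A. tscale (l j) (w j)))
      \<le> \<alpha> E (tscale (l i) (w i)) + \<alpha> E (\<Sum>j\<in>A. tscale (l j) (w j))"
    by (rule s_tensor_norm_triangle[OF assms(1,2)])
  moreover have "\<alpha> E (tscale (l i) (w i)) = norm (l i) * \<alpha> E (w i)"
    using insert.prems by (intro s_tensor_norm_scale[OF assms(1,2)]) blast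
  moreover have "\<alpha> E (\<Sum>j\<in>A. tscale (l j) (w j)) \<le> (\<Sum>j\<in>A. norm (l j) * \<alpha> E (w j))"
    using insert.prems by (intro insert.IH) blast
  ultimately show ?case
    unfolding sum.insert[OF insert.hyps] by linarith
qed

lemma s_tensor_norm_map_le:
  assumes "s_tensor_norm n \<alpha>" "normed_space E" "normed_space F" "T \<in> operators E F"
    and "z \<in> sym_tensor_power n E" "opnorm E F T \<le> b"
  shows "\<alpha> F (sym_map n F T z) \<le> b ^ n * \<alpha> E z"
proof -
  have "\<alpha> F (sym_map n F T z) \<le> opnorm E F T ^ n * \<alpha> E z"
    using assms(1)[unfolded s_tensor_norm_def, THEN conjunct2, rule_format, of E F T z] assms(2-5)
    by blast
  also have "\<dots> \<le> b ^ n * \<alpha> E z"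
    using power_mono[OF assms(6) opnorm_nonneg[OF assms(2-4)]] s_tensor_norm_nonneg[OF assms(1,2,5)]
    by (rule mult_right_mono)
  finally show ?thesis .
qed

lemma tpow_mem [intro]: "x \<in> carrier E \<Longrightarrow> tpow n E x \<in> sym_tensor_power n E"
  unfolding sym_tensor_power_def by (auto intro: tvs.span_base)

text \<open>
  The approximation property enters through this lemma: \<open>\<otimes>\<^sup>n T\<close> moves a given tensor little
  as soon as \<open>T\<close> moves the finitely many vectors of one representation little.
\<close>

lemma s_tensor_norm_sym_map_close:
  assumes "s_tensor_norm n \<alpha>" "normed_space E" "represents n E z r l x" "e > 0"
  shows "\<exists>d>0. \<forall>T. lin_map E E T \<longrightarrow> (\<forall>j<r. nrm E (T (x j) \<ominus>\<^bsub>E\<^esub> x j) < d) \<longrightarrow>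
           \<alpha> E (z - sym_map n E T z) < e"
proof -
  have x: "x j \<in> carrier E" if "j < r" for j
    using assms(3) that by (simp add: represents_def)
  \<comment> \<open>The summand 1 makes \<open>b\<close> positive and the final estimate strict even if all \<open>l j\<close> vanish.\<close>
  define b where "b = (\<Sum>j<r. norm (l j)) + 1"
  have b: "b > 0" unfolding b_def by (intro add_nonneg_pos sum_nonneg) auto
  then have eb: "e / b > 0" using assms(4) by simp
  have "\<forall>j\<in>{..<r}. \<exists>d>0. \<forall>y\<in>carrier E.
      nrm E (y \<ominus>\<^bsub>E\<^esub> x j) < d \<longrightarrow> pi_s n E (tpow n E y - tpow n E (x j)) < e / b"
    using pi_s_tpow_continuous[OF assms(2) x eb] by simp
  then obtain d where d: "\<And>j. j < r \<Longrightarrow> d j > 0"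
    "\<And>j y. j < r \<Longrightarrow> y \<in> carrier E \<Longrightarrow> nrm E (y \<ominus>\<^bsub>E\<^esub> x j) < d j \<Longrightarrow>
        pi_s n E (tpow n E y - tpow n E (x j)) < e / b"
    using bchoice[of "{..<r}"] by (metis lessThan_iff)
  \<comment> \<open>The element 1 keeps the minimum defined for the empty representation \<open>r = 0\<close>.\<close>
  define D where "D = Min (insert 1 (d ` {..<r}))"
  have D: "D > 0" "\<And>j. j < r \<Longrightarrow> D \<le> d j"
    using d(1) by (auto simp: D_def)
  have "\<alpha> E (z - sym_map n E T z) < e"
    if T: "lin_map E E T" and close: "\<forall>j<r. nrm E (T (x j) \<ominus>\<^bsub>E\<^esub> x j) < D" for T
  proof -
    let ?w = "\<lambda>j. tpow n E (T (x j)) - tpow n E (x j)"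
    have Tx: "T (x j) \<in> carrier E" if "j < r" for j
      using T x[OF that] by (auto simp: lin_map_def)
    have w: "?w j \<in> sym_tensor_power n E" if "j < r" for j
      using tpow_mem[OF Tx[OF that]] tpow_mem[OF x[OF that]]
      unfolding sym_tensor_power_def by (rule tvs.span_diff)
    have "z - sym_map n E T z =
        (\<Sum>j<r. tscale (l j) (tpow n E (x j))) - (\<Sum>j<r. tscale (l j) (tpow n E (T (x j))))"
      using assms(3) represents_sym_map[OF T assms(3)] by (simp add: represents_def)
    also have "\<dots> = (\<Sum>j<r. tscale (- l j) (?w j))"
      by (simp add: sum_subtractf[symmetric] tscale_def fun_eq_iff sum_fun_apply algebra_simps)
    finally have "\<alpha> E (z - sym_map n E T z) \<le> (\<Sum>j<r. norm (- l j) * \<alpha> E (?w j))"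
      using s_tensor_norm_sum_le[OF assms(1,2), of "{..<r}" ?w "\<lambda>j. - l j"] w by simp
    also have "\<dots> \<le> (\<Sum>j<r. norm (l j) * (e / b))"
    proof (intro sum_mono)
      fix j assume "j \<in> {..<r}"
      then have j: "j < r" by simp
      have "\<alpha> E (?w j) \<le> pi_s n E (?w j)"
        by (rule s_tensor_norm_le_pi_s[OF assms(1,2) w[OF j]])
      also have "\<dots> < e / b"
        using d(2)[OF j Tx[OF j]] close j D(2)[OF j] by force
      finally show "norm (- l j) * \<alpha> E (?w j) \<le> norm (l j) * (e / b)"
        by (simp del: times_divide_eq_right add: mult_left_mono)
    qed
    also have "\<dots> = (b - 1) * (e / b)"
      unfolding sum_distrib_right[symmetric] by (simp add: b_def)
    also have "\<dots> < e"
      using b assms(4) by (simp add: field_simps)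
    finally show ?thesis .
  qed
  with D(1) show ?thesis by blast
qed

text \<open>
  A tensor of the form \<open>(\<otimes>\<^sup>n T) z\<close> lives on any subspace \<open>M\<close> containing the range of \<open>T\<close>, where
  the two norms can be compared. Factoring \<open>T\<close> as its corestriction to \<open>M\<close> followed
  by the inclusion costs the norm of \<open>T\<close> once for \<open>\<beta>\<close> and nothing for \<open>\<alpha>\<close>.
\<close>

lemma s_tensor_norm_compare_through_subspace:
  assumes "s_tensor_norm n \<alpha>" "s_tensor_norm n \<beta>" "normed_space E" "c \<ge> 0"
    and M: "submodule M scalars E"
    and le: "\<forall>z\<in>sym_tensor_power n (E\<lparr>carrier := M\<rparr>).
      \<alpha> (E\<lparr>carrier := M\<rparr>) z \<le> c * \<beta> (E\<lparr>carrier := M\<rparr>) z"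
    and T: "T \<in> operators E E" "T ` carrier E \<subseteq> M" "opnorm E E T \<le> b"
    and z: "z \<in> sym_tensor_power n E"
  shows "\<alpha> E (sym_map n E T z) \<le> b ^ n * c * \<beta> E z"
proof -
  let ?F = "E\<lparr>carrier := M\<rparr>"
  have F: "normed_space ?F"
    using assms(3) M by (rule normed_space.normed_subspace)
  have S: "T \<in> operators E ?F"
    using assms(3) M T(1,2) by (rule corestriction_in_operators)
  note I = inclusion_operator[OF assms(3) M]
  obtain r l x where rep: "represents n E z r l x"
    using z sym_tensor_power_iff by blast
  define w where "w = sym_map n ?F T z"
  have w_rep: "represents n ?F w r l (\<lambda>j. T (x j))"
    unfolding w_def using S rep by (intro represents_sym_map) (auto simp: operators_def)
  then have w: "w \<in> sym_tensor_power n ?F"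
    using sym_tensor_power_iff by blast
  have "represents n E (sym_map n E (\<lambda>x. x) w) r l (\<lambda>j. T (x j))"
    using I(1) w_rep by (intro represents_sym_map) (auto simp: operators_def)
  moreover have "represents n E (sym_map n E T z) r l (\<lambda>j. T (x j))"
    using T(1) rep by (intro represents_sym_map) (auto simp: operators_def)
  ultimately have "\<alpha> E (sym_map n E T z) = \<alpha> E (sym_map n E (\<lambda>x. x) w)"
    by (simp add: represents_def)
  also have "\<dots> \<le> 1 ^ n * \<alpha> ?F w"
    using assms(1) F assms(3) I(1) w I(2) by (rule s_tensor_norm_map_le)
  also have "\<dots> \<le> c * \<beta> ?F w"
    using le w by simp
  also have "\<dots> \<le> c * (b ^ n * \<beta> E z)"
  proof (rule mult_left_mono[OF _ \<open>c \<ge> 0\<close>])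
    have "opnorm E ?F T \<le> b" using T(3) by (simp add: opnorm_def)
    with assms(2,3) F S z show "\<beta> ?F w \<le> b ^ n * \<beta> E z"
      unfolding w_def by (rule s_tensor_norm_map_le)
  qed
  finally show ?thesis by (simp add: mult_ac)
qed

theorem lemma2p1:
  fixes n :: nat
    and \<alpha> \<beta> :: "('k::real_normed_field, 'a) normed \<Rightarrow> ('k, 'a) tensor \<Rightarrow> real"
    and E :: "('k, 'a) normed"
    and lam c :: real
  assumes "s_tensor_norm n \<alpha>"
    and "s_tensor_norm n \<beta>"
    and "normed_space E"
    and "bounded_approximation_property lam E"
    and "c \<ge> 0"
    and "\<exists>\<M> \<subseteq> FIN E. (\<forall>N\<in>FIN E. \<exists>M\<in>\<M>. N \<subseteq> M) \<and>
           (\<forall>M\<in>\<M>. \<forall>z\<in>sym_tensor_power n (E\<lparr>carrier := M\<rparr>).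
              \<alpha> (E\<lparr>carrier := M\<rparr>) z \<le> c * \<beta> (E\<lparr>carrier := M\<rparr>) z)"
  shows "\<forall>z\<in>sym_tensor_power n E. \<alpha> E z \<le> lam ^ n * c * \<beta> E z"
proof (rule ballI, rule field_le_epsilon)
  fix z and e :: real
  assume z: "z \<in> sym_tensor_power n E" and "e > 0"
  obtain r l x where rep: "represents n E z r l x"
    using z sym_tensor_power_iff by blast
  obtain d where "d > 0" and d: "\<And>T. lin_map E E T \<Longrightarrow>
      \<forall>j<r. nrm E (T (x j) \<ominus>\<^bsub>E\<^esub> x j) < d \<Longrightarrow> \<alpha> E (z - sym_map n E T z) < e"
    using s_tensor_norm_sym_map_close[OF assms(1,3) rep \<open>e > 0\<close>] by blast
  have "compactin (ntop E) (x ` {..<r})"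
    unfolding ntop_def using rep
    by (intro finite_imp_compactin)
      (auto simp: represents_def
        Metric_space.topspace_mtopology[OF normed_space.Metric_space_ndist[OF assms(3)]])
  with assms(4) \<open>d > 0\<close> obtain \<T> :: "('a \<Rightarrow> 'a) filter" where "\<T> \<noteq> bot"
    and ev: "\<forall>\<^sub>F T in \<T>. T \<in> finite_rank_operators E \<and> opnorm E E T \<le> lam"
    and ev_close: "\<forall>\<^sub>F T in \<T>. \<forall>y\<in>x ` {..<r}. nrm E (T y \<ominus>\<^bsub>E\<^esub> y) < d"
    unfolding bounded_approximation_property_def by blast
  obtain T where fin: "T \<in> finite_rank_operators E" and T_le: "opnorm E E T \<le> lam"
    and close: "\<forall>y\<in>x ` {..<r}. nrm E (T y \<ominus>\<^bsub>E\<^esub> y) < d"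
    using eventually_happens'[OF \<open>\<T> \<noteq> bot\<close> eventually_conj[OF ev ev_close]] by blast
  have T: "T \<in> operators E E" "lin_map E E T" "T ` carrier E \<in> FIN E"
    using fin by (auto simp: finite_rank_operators_def operators_def)
  obtain \<M> where sub: "\<M> \<subseteq> FIN E" and cofinal: "\<forall>N\<in>FIN E. \<exists>M\<in>\<M>. N \<subseteq> M"
    and compare: "\<forall>M\<in>\<M>. \<forall>z\<in>sym_tensor_power n (E\<lparr>carrier := M\<rparr>).
      \<alpha> (E\<lparr>carrier := M\<rparr>) z \<le> c * \<beta> (E\<lparr>carrier := M\<rparr>) z"
    using assms(6) by (elim exE conjE) (rule that)
  obtain M where "M \<in> \<M>" and range: "T ` carrier E \<subseteq> M"
    using bspec[OF cofinal T(3)] by (rule bexE)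
  have M: "submodule M scalars E"
    using subsetD[OF sub \<open>M \<in> \<M>\<close>] by (simp add: FIN_def)
  have Tz: "sym_map n E T z \<in> sym_tensor_power n E"
    using represents_sym_map[OF T(2) rep] sym_tensor_power_iff by blast
  then have "z - sym_map n E T z \<in> sym_tensor_power n E"
    using z unfolding sym_tensor_power_def by (intro tvs.span_diff)
  from s_tensor_norm_triangle[OF assms(1,3) Tz this]
  have "\<alpha> E z \<le> \<alpha> E (sym_map n E T z) + \<alpha> E (z - sym_map n E T z)"
    by simp
  moreover have "\<alpha> E (sym_map n E T z) \<le> lam ^ n * c * \<beta> E z"
    by (rule s_tensor_norm_compare_through_subspace[OF assms(1-3,5) M
          bspec[OF compare \<open>M \<in> \<M>\<close>] T(1) range T_le z])
  moreover have "\<alpha> E (z - sym_map n E T z) < e"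
    using T(2) close by (intro d) auto
  ultimately show "\<alpha> E z \<le> lam ^ n * c * \<beta> E z + e" by linarith
qed

end
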